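(* Let $(a_n)_{n\geq 1}$ and $(b_n)_{n\geq 1}$ be the sequences defined by \[a_n=\sum_{k=1}^{\left\lfloor\frac{n-1}{2}\right\rfloor}\left(2k^2+2(n-k)^2+k(n-k)\right),\qquad b_n=\sum_{k=1}^{\left\lfloor\frac n3\right\rfloor}\ \sum_{i=k}^{\left\lfloor\frac{n-k}{2}\right\rfloor} ik(n-i-k).\] Let $A(x)=\sum_{n\geq 1}a_nx^n$ and $B(x)=\sum_{n\geq 1}b_nx^n$ be the generating functions of the two sequences, respectively. Then \[A(x)=\frac{x^3(2x^3+11x^2+11x+12)}{(1-x)^4(1+x)^3},\] \[B(x)=\frac{x^3(6x^8+14x^7+18x^6+21x^5+23x^4+15x^3+7x^2+3x+1)}{(1-x)^6(1+x)^3(x^2+x+1)^4}.\]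
   Context: Empty sums are equal to $0$. The identities are identities of formal power series. *)

theory Defs
  imports Complex_Main "HOL-Computational_Algebra.Formal_Power_Series"
begin

(* The indices are integers, so that subtraction does not truncate; on integers,
   m div d is the floor of m / d for d > 0. *)

definition a_seq :: "nat \<Rightarrow> int" where
  "a_seq n = (\<Sum>k = 1..(int n - 1) div 2.
      2 * k\<^sup>2 + 2 * (int n - k)\<^sup>2 + k * (int n - k))"

definition b_seq :: "nat \<Rightarrow> int" where
  "b_seq n = (\<Sum>k = 1..int n div 3. \<Sum>i = k..(int n - k) div 2.
      i * k * (int n - i - k))"

(* The sequences start at n = 1, so the constant coefficient is 0. The coefficients
   are taken in the rationals, where a power series with nonzero constant coefficient
   is invertible and division by it is the division of power series. *)
definition gen_fun :: "(nat \<Rightarrow> int) \<Rightarrow> rat fps" where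
  "gen_fun s = Abs_fps (\<lambda>n. if n \<ge> 1 then of_int (s n) else 0)"

end

theory Submission
  imports Defs
begin

text \<open>Subtracting 1 from every part maps the pairs \<open>(k, j)\<close>, \<open>1 \<le> k \<le> j\<close> (or \<open>1 \<le> k < j\<close>),
  with sum \<open>n + 2\<close> and \<open>k > 1\<close> to those with sum \<open>n\<close>, and the triples \<open>1 \<le> k \<le> i \<le> j\<close> with sum
  \<open>n + 3\<close> and \<open>k > 1\<close> to those with sum \<open>n\<close>. Summing a polynomial weight therefore gives, after
  multiplication by \<open>1 - x\<^sup>2\<close> or \<open>1 - x\<^sup>3\<close>, generating functions of weights of lower degree or of
  tuples with one part fewer. For the weight \<open>k i j\<close> all weights that occur are elementary symmetric
  polynomials, which leaves a triangular linear system.\<close>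

(* The offset d is 0 for pairs k \<le> j and 1 for pairs k < j. *)
definition pair_sum :: "int \<Rightarrow> (int \<Rightarrow> int \<Rightarrow> int) \<Rightarrow> nat \<Rightarrow> int" where
  "pair_sum d f n = (\<Sum>k = 1..(int n - d) div 2. f k (int n - k))"

definition triple_sum :: "(int \<Rightarrow> int \<Rightarrow> int \<Rightarrow> int) \<Rightarrow> nat \<Rightarrow> int" where
  "triple_sum f n =
     (\<Sum>k = 1..int n div 3. \<Sum>i = k..(int n - k) div 2. f k i (int n - i - k))"

text \<open>The coefficient at 0 is kept, so recurrences transfer without a case distinction. For
  sequences that vanish at 0 this agrees with \<open>gen_fun\<close>.\<close>

definition int_fps :: "(nat \<Rightarrow> int) \<Rightarrow> rat fps" where
  "int_fps s = Abs_fps (\<lambda>n. of_int (s n))"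

lemma int_fps_nth [simp]: "fps_nth (int_fps s) n = of_int (s n)"
  by (simp add: int_fps_def)

lemma fps_numeral_mult_nth [simp]: "fps_nth (numeral c * F) n = numeral c * fps_nth F n"
  for F :: "'a::comm_ring_1 fps"
  by (simp add: numeral_fps_const)

section \<open>Recurrences from lowering every part by one\<close>

lemma sum_shift_int: "(\<Sum>k = a + 1..b + 1. f k) = (\<Sum>k = a..b. f (k + 1))" for a b :: int
  by (rule sum.reindex_bij_witness[of _ "\<lambda>k. k + 1" "\<lambda>k. k - 1"]) auto

lemma sum_first_int: "(\<Sum>k = 1..b + 1. f k) = f 1 + (\<Sum>k = 1..b. f (k + 1))"
  if "b \<ge> 0" for b :: int
proof -
  have "{1..b + 1} = insert 1 {1 + 1..b + 1}" using that by auto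
  then have "(\<Sum>k = 1..b + 1. f k) = f 1 + (\<Sum>k = 1 + 1..b + 1. f k)" by simp
  then show ?thesis by (simp only: sum_shift_int)
qed

text \<open>The pair with \<open>k = 1\<close> is \<open>(1, n + 1)\<close>. It is missing from the
  range only for \<open>n = 0\<close> and \<open>d = 1\<close>, where it would be the non-strict
  pair \<open>(1, 1)\<close>.\<close>

lemma pair_sum_rec:
  assumes "d \<in> {0, 1}"
  shows "pair_sum d f (n + 2) =
    (if int n \<ge> d then f 1 (int n + 1) else 0) + pair_sum d (\<lambda>k j. f (k + 1) (j + 1)) n"
proof (cases "int n \<ge> d")
  case True
  have "(int (n + 2) - d) div 2 = (int n - d) div 2 + 1" by simp
  then have "pair_sum d f (n + 2) =
      (\<Sum>k = 1..(int n - d) div 2 + 1. f k (int (n + 2) - k))"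
    by (simp only: pair_sum_def)
  also have "\<dots> = f 1 (int n + 1) + pair_sum d (\<lambda>k j. f (k + 1) (j + 1)) n"
    unfolding pair_sum_def using True by (subst sum_first_int) (simp_all add: algebra_simps)
  finally show ?thesis using True by simp
next
  case False
  with assms have "n = 0" "d = 1" by auto
  then show ?thesis by (simp add: pair_sum_def)
qed

text \<open>A triple with \<open>k = 1\<close> leaves a pair \<open>i\<close>, \<open>j\<close> with
  sum \<open>n + 2\<close> in which equality is allowed, hence the offset 0.\<close>

lemma triple_sum_rec:
  "triple_sum f (n + 3) =
     pair_sum 0 (f 1) (n + 2) + triple_sum (\<lambda>k i j. f (k + 1) (i + 1) (j + 1)) n"
proof -
  have "int (n + 3) div 3 = int n div 3 + 1" by simp
  then have "triple_sum f (n + 3) =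
      (\<Sum>i = 1..(int (n + 3) - 1) div 2. f 1 i (int (n + 3) - i - 1)) +
      (\<Sum>k = 1..int n div 3. \<Sum>i = k + 1..(int (n + 3) - (k + 1)) div 2.
         f (k + 1) i (int (n + 3) - i - (k + 1)))"
    by (simp add: triple_sum_def sum_first_int)
  moreover have "(\<Sum>i = k + 1..(int (n + 3) - (k + 1)) div 2. g i) =
      (\<Sum>i = k..(int n - k) div 2. g (i + 1))" for k and g :: "int \<Rightarrow> int"
  proof -
    \<comment> \<open>Lowering the total by 3 and \<open>k\<close> by 1 lowers the numerator by 2,
      so the bound drops by exactly 1 in either parity.\<close>
    have "(int (n + 3) - (k + 1)) div 2 = (int n - k) div 2 + 1" by presburger
    then show ?thesis by (simp only: sum_shift_int)
  qed
  ultimately show ?thesis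
    by (simp add: triple_sum_def pair_sum_def algebra_simps)
qed

section \<open>Power series equations\<close>

lemma pair_sum_0 [simp]: "d \<ge> 0 \<Longrightarrow> pair_sum d f 0 = 0"
  and pair_sum_1 [simp]: "d \<ge> 0 \<Longrightarrow> pair_sum d f (Suc 0) = 0"
  by (auto simp: pair_sum_def intro!: sum.neutral)

lemma triple_sum_less_3: "n < 3 \<Longrightarrow> triple_sum f n = 0"
  by (simp add: triple_sum_def)


lemma int_fps_pair_sum:
  assumes "d \<in> {0, 1}"
  shows "int_fps (pair_sum d f) =
    fps_X^2 * (int_fps (\<lambda>n. if int n \<ge> d then f 1 (int n + 1) else 0)
      + int_fps (pair_sum d (\<lambda>k j. f (k + 1) (j + 1))))" (is "?l = ?r")
proof (rule fps_ext)
  fix n :: nat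
  consider "n < 2" | m where "n = m + 2" using that(2)[of "n - 2"] by linarith
  then show "fps_nth ?l n = fps_nth ?r n"
  proof cases
    case 1
    then have "n = 0 \<or> n = Suc 0" by auto
    with assms show ?thesis by (auto simp: fps_X_power_mult_nth)
  next
    case 2
    then show ?thesis using pair_sum_rec[OF assms, of f m]
      by (simp add: fps_X_power_mult_nth)
  qed
qed

text \<open>Removing the part 1 costs a single power of x, since the remaining pair is not lowered;
  lowering all three parts costs x^3. Coefficients below 3 vanish on the right because pair sums
  vanish at 0 and 1.\<close>

lemma int_fps_triple_sum:
  "int_fps (triple_sum f) = fps_X * int_fps (pair_sum 0 (f 1))
     + fps_X^3 * int_fps (triple_sum (\<lambda>k i j. f (k + 1) (i + 1) (j + 1)))" (is "?l = ?r")
proof (rule fps_ext)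
  fix n :: nat
  consider "n < 3" | m where "n = m + 3" using that(2)[of "n - 3"] by linarith
  then show "fps_nth ?l n = fps_nth ?r n"
  proof cases
    case 1
    then have "n = 0 \<or> n = Suc 0 \<or> n = Suc (Suc 0)" by auto
    then show ?thesis by (auto simp: fps_X_power_mult_nth triple_sum_less_3)
  next
    case 2
    then show ?thesis using triple_sum_rec[of f m]
      by (simp add: fps_X_power_mult_nth)
  qed
qed

lemma pair_sum_add: "pair_sum d (\<lambda>k j. f k j + g k j) n = pair_sum d f n + pair_sum d g n"
  and pair_sum_cmult: "pair_sum d (\<lambda>k j. c * f k j) n = c * pair_sum d f n"
  by (simp_all add: pair_sum_def sum.distrib sum_distrib_left)

lemma triple_sum_add:
    "triple_sum (\<lambda>k i j. f k i j + g k i j) n = triple_sum f n + triple_sum g n"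
  and triple_sum_cmult: "triple_sum (\<lambda>k i j. c * f k i j) n = c * triple_sum f n"
  by (simp_all add: triple_sum_def sum.distrib sum_distrib_left)

text \<open>These series collect the contributions of the pairs \<open>(1, n + 1)\<close>.
  Multiplication by 1 - x takes first differences, and (n+1)^2 - n^2 = 2(n+1) - 1.\<close>

lemma int_fps_one: "(1 - fps_X) * int_fps (\<lambda>n. 1) = 1"
  and int_fps_Suc: "(1 - fps_X) * int_fps (\<lambda>n. int n + 1) = int_fps (\<lambda>n. 1)"
  and int_fps_Suc_sq: "(1 - fps_X) * int_fps (\<lambda>n. (int n + 1)\<^sup>2) =
     2 * int_fps (\<lambda>n. int n + 1) - int_fps (\<lambda>n. 1)"
proof -
  have telescope: "fps_nth ((1 - fps_X) * F) n =
      fps_nth F n - (if n = 0 then 0 else fps_nth F (n - 1))" for F :: "rat fps" and n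
    by (simp add: left_diff_distrib)
  show "(1 - fps_X) * int_fps (\<lambda>n. 1) = 1"
    by (rule fps_ext) (simp only: telescope, simp)
  show "(1 - fps_X) * int_fps (\<lambda>n. int n + 1) = int_fps (\<lambda>n. 1)"
    by (rule fps_ext) (simp only: telescope, simp add: of_nat_diff)
  show "(1 - fps_X) * int_fps (\<lambda>n. (int n + 1)\<^sup>2) =
     2 * int_fps (\<lambda>n. int n + 1) - int_fps (\<lambda>n. 1)"
    by (rule fps_ext)
      (simp only: telescope, simp add: of_nat_diff power2_eq_square algebra_simps fps_numeral_nth)
qed


section \<open>The series of \<open>a_seq\<close>\<close>

lemma a_fps:
  "int_fps a_seq * ((1 - fps_X)^4 * (1 + fps_X)^3) =
     fps_X^3 * (2 * fps_X^3 + 11 * fps_X^2 + 11 * fps_X + 12)"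
proof -
  define x :: "rat fps" where "x = fps_X"
  define G0 where "G0 = int_fps (\<lambda>n. 1)"
  define G1 where "G1 = int_fps (\<lambda>n. int n + 1)"
  define G2 where "G2 = int_fps (\<lambda>n. (int n + 1)\<^sup>2)"
  \<comment> \<open>Lowering both parts changes the weight of \<open>a_seq\<close> by a combination
    of \<open>k + j\<close> and 1, so these three weights form a closed system.\<close>
  define P0 where "P0 = int_fps (pair_sum 1 (\<lambda>k j. 1))"
  define P1 where "P1 = int_fps (pair_sum 1 (\<lambda>k j. k + j))"
  define A where "A = int_fps (pair_sum 1 (\<lambda>k j. 2 * k\<^sup>2 + 2 * j\<^sup>2 + k * j))"
  note defs = x_def G0_def G1_def G2_def P0_def P1_def A_def
  have G: "(1 - x) * G0 = 1" "(1 - x) * G1 = G0" "(1 - x) * G2 = 2 * G1 - G0"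
    unfolding defs by (fact int_fps_one int_fps_Suc int_fps_Suc_sq)+
  \<comment> \<open>Strictness removes the boundary term at \<open>n = 0\<close>. The subtracted
    constant is the weight at \<open>(1, 1)\<close>: 1 here, 2 for \<open>P1\<close>, 5 for
    \<open>A\<close>.\<close>
  have P0: "P0 = x^2 * ((G0 - 1) + P0)"
    unfolding P0_def
    by (subst int_fps_pair_sum, simp)
      (rule arg_cong2[where f = "(*)"], simp add: x_def, rule fps_ext, simp add: G0_def)
  have shift1: "k + 1 + (j + 1) = (k + j) + 2 * 1" for k j :: int by simp
  have P1: "P1 = x^2 * ((G1 + G0 - 2) + (P1 + 2 * P0))"
    unfolding P1_def
    by (subst int_fps_pair_sum, simp)
      (rule arg_cong2[where f = "(*)"], simp add: x_def, rule fps_ext,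
       simp only: shift1 pair_sum_add pair_sum_cmult int_fps_nth fps_add_nth,
       simp add: G0_def G1_def P0_def pair_sum_add fps_numeral_nth)
  have shift2: "2 * (k + 1)\<^sup>2 + 2 * (j + 1)\<^sup>2 + (k + 1) * (j + 1) =
      (2 * k\<^sup>2 + 2 * j\<^sup>2 + k * j) + (5 * (k + j) + 5 * 1)" for k j :: int by algebra
  have A: "A = x^2 * ((2 * G0 + 2 * G2 + G1 - 5) + (A + (5 * P1 + 5 * P0)))"
    unfolding A_def
    by (subst int_fps_pair_sum, simp)
      (rule arg_cong2[where f = "(*)"], simp add: x_def, rule fps_ext,
       simp only: shift2 pair_sum_add pair_sum_cmult int_fps_nth fps_add_nth,
       simp add: G0_def G1_def G2_def P0_def P1_def pair_sum_add fps_numeral_nth)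
  \<comment> \<open>Factors \<open>p\<close> clear the boundary series; solving each equation for
    its unknown costs one factor \<open>q\<close>.\<close>
  define p q where "p = 1 - x" and "q = 1 - x^2"
  note Gp = G[folded p_def]
  have "P0 * (p * q) = x^3"
    using P0 Gp(1) unfolding p_def q_def by algebra
  moreover have "P1 * q = x^2 * (G1 + G0 - 2 + 2 * P0)"
    using P1 unfolding q_def by algebra
  ultimately have P1': "P1 * (p^2 * q^2) = x^2 * ((1 + p - 2 * p^2) * q + 2 * x^3 * p)"
    using Gp by algebra
  have "A * q = x^2 * (2 * G0 + 2 * G2 + G1 - 5 + 5 * P1 + 5 * P0)"
    using A unfolding q_def by algebra
  then have "A * (p^3 * q^3) = x^2 * ((2 * p^2 + 2 * (2 - p) + p - 5 * p^3) * q^2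
      + 5 * p * (x^2 * ((1 + p - 2 * p^2) * q + 2 * x^3 * p)) + 5 * x^3 * p^2 * q)"
    using Gp P1' \<open>P0 * (p * q) = x^3\<close> by algebra
  \<comment> \<open>Since q = p(1 + x), the denominator p^3 q^3 exceeds the claimed one by p^2. The
    numerator contains the same factor, which cancels because \<open>p * G0 = 1\<close> makes
    \<open>p\<close> nonzero.\<close>
  also have "\<dots> = x^3 * (2 * x^3 + 11 * x^2 + 11 * x + 12) * p^2"
    unfolding p_def q_def by algebra
  also have "A * (p^3 * q^3) = A * (p^4 * (1 + x)^3) * p^2"
    unfolding p_def q_def by algebra
  finally have "A * (p^4 * (1 + x)^3) = x^3 * (2 * x^3 + 11 * x^2 + 11 * x + 12)"
    using Gp(1) by auto
  moreover have "int_fps a_seq = A"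
    by (simp add: A_def a_seq_def pair_sum_def int_fps_def)
  ultimately show ?thesis by (simp add: p_def x_def)
qed

section \<open>The series of \<open>b_seq\<close>\<close>

lemma b_fps:
  "int_fps b_seq * ((1 - fps_X)^6 * (1 + fps_X)^3 * (fps_X^2 + fps_X + 1)^4) =
     fps_X^3 * (6 * fps_X^8 + 14 * fps_X^7 + 18 * fps_X^6 + 21 * fps_X^5 + 23 * fps_X^4
                      + 15 * fps_X^3 + 7 * fps_X^2 + 3 * fps_X + 1)"
proof -
  define x :: "rat fps" where "x = fps_X"
  define G0 where "G0 = int_fps (\<lambda>n. 1)"
  define G1 where "G1 = int_fps (\<lambda>n. int n + 1)"
  define P0 where "P0 = int_fps (pair_sum 0 (\<lambda>i j. 1))"
  define P1 where "P1 = int_fps (pair_sum 0 (\<lambda>i j. i + j))"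
  define P2 where "P2 = int_fps (pair_sum 0 (\<lambda>i j. i * j))"
  \<comment> \<open>At \<open>k = 1\<close> these weights become sums of the pair weights 1,
    \<open>i + j\<close> and \<open>i * j\<close>, which \<open>P0\<close>, \<open>P1\<close> and
    \<open>P2\<close> cover.\<close>
  define E0 where "E0 = int_fps (triple_sum (\<lambda>k i j. 1))"
  define E1 where "E1 = int_fps (triple_sum (\<lambda>k i j. k + i + j))"
  define E2 where "E2 = int_fps (triple_sum (\<lambda>k i j. k * i + k * j + i * j))"
  define E3 where "E3 = int_fps (triple_sum (\<lambda>k i j. i * k * j))"
  note defs = x_def G0_def G1_def P0_def P1_def P2_def E0_def E1_def E2_def E3_def
  have G: "(1 - x) * G0 = 1" "(1 - x) * G1 = G0"
    unfolding defs by (fact int_fps_one int_fps_Suc)+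
  \<comment> \<open>Equal parts are allowed here, so the boundary term is present for every
    \<open>n\<close> and nothing is subtracted.\<close>
  have P0: "P0 = x^2 * (G0 + P0)"
    unfolding P0_def
    by (subst int_fps_pair_sum, simp)
      (rule arg_cong2[where f = "(*)"], simp add: x_def, rule fps_ext, simp add: G0_def)
  have p1: "i + 1 + (j + 1) = (i + j) + 2 * 1"
    and p2: "(i + 1) * (j + 1) = i * j + ((i + j) + 1)" for i j :: int
    by algebra+
  have P1: "P1 = x^2 * ((G1 + G0) + (P1 + 2 * P0))"
    unfolding P1_def
    by (subst int_fps_pair_sum, simp)
      (rule arg_cong2[where f = "(*)"], simp add: x_def, rule fps_ext,
       simp only: p1 pair_sum_add pair_sum_cmult int_fps_nth fps_add_nth,
       simp add: G0_def G1_def P0_def pair_sum_add)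
  have P2: "P2 = x^2 * (G1 + (P2 + (P1 + P0)))"
    unfolding P2_def
    by (subst int_fps_pair_sum, simp)
      (rule arg_cong2[where f = "(*)"], simp add: x_def, rule fps_ext,
       simp only: p2 pair_sum_add pair_sum_cmult int_fps_nth fps_add_nth,
       simp add: G1_def P1_def P0_def pair_sum_add)
  have E0: "E0 = x * P0 + x^3 * E0"
    unfolding E0_def P0_def x_def by (rule int_fps_triple_sum)
  have e1: "k + 1 + (i + 1) + (j + 1) = k + i + j + 3 * 1"
      "1 + i + j = 1 + (i + j)"
    and e2: "(k + 1) * (i + 1) + (k + 1) * (j + 1) + (i + 1) * (j + 1) =
      (k * i + k * j + i * j) + (2 * (k + i + j) + 3 * 1)"
      "1 * i + 1 * j + i * j = (i + j) + i * j"
    and e3: "(i + 1) * (k + 1) * (j + 1) =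
      i * k * j + ((k * i + k * j + i * j) + ((k + i + j) + 1))"
    for k i j :: int
    by algebra+
  have E1: "E1 = x * (P0 + P1) + x^3 * (E1 + 3 * E0)"
    unfolding E1_def
    by (subst int_fps_triple_sum)
      (intro arg_cong2[where f = "(+)"] arg_cong2[where f = "(*)"] x_def[symmetric] refl fps_ext;
       (simp only: x_def | simp only: e1 pair_sum_add triple_sum_add triple_sum_cmult
          int_fps_nth fps_add_nth fps_numeral_mult_nth of_int_add of_int_mult of_int_numeral defs))
  have E2: "E2 = x * (P1 + P2) + x^3 * (E2 + (2 * E1 + 3 * E0))"
    unfolding E2_def
    by (subst int_fps_triple_sum)
      (intro arg_cong2[where f = "(+)"] arg_cong2[where f = "(*)"] fps_ext;
       (simp only: x_def | simp only: e2 pair_sum_add triple_sum_add triple_sum_cmult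
          int_fps_nth fps_add_nth fps_numeral_mult_nth of_int_add of_int_mult of_int_numeral defs))
  have E3: "E3 = x * P2 + x^3 * (E3 + (E2 + (E1 + E0)))"
    unfolding E3_def
    by (subst int_fps_triple_sum)
      (intro arg_cong2[where f = "(+)"] arg_cong2[where f = "(*)"] fps_ext;
       (simp only: x_def | simp only: e3 mult_1_right pair_sum_add triple_sum_add triple_sum_cmult
          int_fps_nth fps_add_nth fps_numeral_mult_nth of_int_add of_int_mult of_int_numeral defs))
  define p q r where "p = 1 - x" and "q = 1 - x^2" and "r = 1 - x^3"
  note Gp = G[folded p_def]
  \<comment> \<open>Numerators of \<open>P1\<close>, \<open>P2\<close>, \<open>E1\<close>,
    \<open>E2\<close> over p^2 q^2, p^2 q^3, p^2 q^2 r^2, p^2 q^3 r^3. Naming them delays the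
    expansion in x to a single polynomial identity.\<close>
  define N1 where "N1 = x^2 * ((1 + p) * q + 2 * x^2 * p)"
  define N2 where "N2 = x^2 * (q^2 + N1 + x^2 * p * q)"
  define M1 where "M1 = x * r * (x^2 * p * q + N1) + 3 * x^6 * p * q"
  define M2 where "M2 = x * r^2 * (N1 * q + N2) + x^3 * (2 * M1 * q + 3 * x^3 * p * q^2 * r)"
  have "P0 * q = x^2 * G0"
    using P0 unfolding q_def by algebra
  then have P0': "P0 * (p * q) = x^2"
    using Gp by algebra
  have "P1 * q = x^2 * (G1 + G0 + 2 * P0)"
    using P1 unfolding q_def by algebra
  then have P1': "P1 * (p^2 * q^2) = N1"
    using Gp P0' unfolding N1_def by algebra
  have "P2 * q = x^2 * (G1 + P1 + P0)"
    using P2 unfolding q_def by algebra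
  then have P2': "P2 * (p^2 * q^3) = N2"
    using Gp P0' P1' unfolding N2_def by algebra
  have "E0 * r = x * P0"
    using E0 unfolding r_def by algebra
  then have E0': "E0 * (p * q * r) = x^3"
    using P0' by algebra
  have "E1 * r = x * (P0 + P1) + 3 * x^3 * E0"
    using E1 unfolding r_def by algebra
  then have E1': "E1 * (p^2 * q^2 * r^2) = M1"
    using P0' P1' E0' unfolding M1_def by algebra
  have "E2 * r = x * (P1 + P2) + x^3 * (2 * E1 + 3 * E0)"
    using E2 unfolding r_def by algebra
  then have E2': "E2 * (p^2 * q^3 * r^3) = M2"
    using P1' P2' E0' E1' unfolding M2_def by algebra
  have "E3 * r = x * P2 + x^3 * (E2 + E1 + E0)"
    using E3 unfolding r_def by algebra
  then have "E3 * (p^2 * q^3 * r^4) =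
      x * r^3 * N2 + x^3 * (M2 + M1 * q * r + x^3 * p * q^2 * r^2)"
    using P2' E0' E1' E2' by algebra
  \<comment> \<open>Both \<open>q\<close> and \<open>r\<close> are divisible by \<open>p\<close>, so
    p^2 q^3 r^4 has three more factors \<open>p\<close> than the claimed denominator; the numerator
    supplies p^3 to cancel them.\<close>
  also have "\<dots> = x^3 * (6 * x^8 + 14 * x^7 + 18 * x^6 + 21 * x^5 + 23 * x^4
      + 15 * x^3 + 7 * x^2 + 3 * x + 1) * p^3"
    unfolding M2_def M1_def N2_def N1_def p_def q_def r_def by algebra
  also have "E3 * (p^2 * q^3 * r^4) = E3 * (p^6 * (1 + x)^3 * (x^2 + x + 1)^4) * p^3"
  proof -
    have "q = p * (1 + x)" "r = p * (x^2 + x + 1)"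
      unfolding p_def q_def r_def by algebra+
    then show ?thesis by algebra
  qed
  finally have "E3 * (p^6 * (1 + x)^3 * (x^2 + x + 1)^4) =
      x^3 * (6 * x^8 + 14 * x^7 + 18 * x^6 + 21 * x^5 + 23 * x^4
        + 15 * x^3 + 7 * x^2 + 3 * x + 1)"
    using Gp(1) by auto
  moreover have "int_fps b_seq = E3"
    by (simp add: E3_def b_seq_def triple_sum_def int_fps_def)
  ultimately show ?thesis by (simp add: p_def x_def)
qed

text \<open>Turns the identities with cleared denominators into quotients. Both denominators are
  products of factors with constant coefficient 1, so the last assumption is a direct
  evaluation.\<close>

lemma gen_fun_eq_divide:
  assumes "s 0 = 0" "int_fps s * D = N" "fps_nth D 0 \<noteq> 0"
  shows "gen_fun s = N / D"
proof -
  have "gen_fun s = int_fps s"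
    using assms(1) by (auto simp: gen_fun_def fps_eq_iff not_less_eq_eq)
  moreover have "D \<noteq> 0" using assms(3) by auto
  ultimately show ?thesis using assms(2) by (metis nonzero_mult_div_cancel_right)
qed

theorem theorem8:
  shows "gen_fun a_seq =
           fps_X^3 * (2 * fps_X^3 + 11 * fps_X^2 + 11 * fps_X + 12)
             / ((1 - fps_X)^4 * (1 + fps_X)^3)
       \<and> gen_fun b_seq =
           fps_X^3 * (6 * fps_X^8 + 14 * fps_X^7 + 18 * fps_X^6 + 21 * fps_X^5 + 23 * fps_X^4
                      + 15 * fps_X^3 + 7 * fps_X^2 + 3 * fps_X + 1)
             / ((1 - fps_X)^6 * (1 + fps_X)^3 * (fps_X^2 + fps_X + 1)^4)"
  using gen_fun_eq_divide[OF _ a_fps] gen_fun_eq_divide[OF _ b_fps]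
  by (simp add: a_seq_def b_seq_def fps_power_zeroth)

end
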